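(* Let $n \geq 1$ and $r \geq 2$ be integers. For $\mathbf{m}=(m_1,\dots,m_n)\in \mathbb{N}^n$ let $\mathcal{W}(\mathbf{m})$ be the set of words over the alphabet $\{1,\dots,n\}$ containing exactly $m_i$ copies of the letter $i$ for each $i$, and let $$g_r(\mathbf{m};t)=\sum_{w\in\mathcal{W}(\mathbf{m})} t^{\alpha(w)},$$ where $\alpha(w)$ is the number of occurrences in $w$ of the consecutive pattern $12\cdots r$, i.e. the number of indices $i$ with $w_i<w_{i+1}<\dots<w_{i+r-1}$. Define polynomials $P^{(r)}_k(t)$ for integers $k\ge 1$ by $P^{(r)}_k(t)=0$ if $k<r$, $P^{(r)}_r(t)=t-1$, and $P^{(r)}_k(t)=(t-1)\sum_{i=1}^{r-1}P^{(r)}_{k-i}(t)$ for $k>r$. Then the generating function $$G_r(x_1,\dots,x_n;t)=\sum_{\mathbf{m}\in\mathbb{N}^n} g_r(\mathbf{m};t)\,x_1^{m_1}\cdots x_n^{m_n}$$ satisfies $$G_r(x_1,\dots,x_n;t)=\frac{1}{1-e_1-\sum_{k=r}^{n}P^{(r)}_k(t)\,e_k},$$ where $e_k$ denotes the elementary symmetric polynomial of degree $k$ in $x_1,\dots,x_n$.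
   Context: Words are finite sequences $w=w_1w_2\cdots w_L$ of letters from $\{1,\dots,n\}$; patterns are counted consecutively (as contiguous factors). The elementary symmetric polynomial $e_k$ is the coefficient of $z^k$ in $(1+x_1z)\cdots(1+x_nz)$. *)

theory Defs
  imports
    "HOL-Computational_Algebra.Polynomial"
    "HOL-Library.Poly_Mapping"
    "HOL-Library.FuncSet"
begin

section \<open>Formal power series in several variables\<close>

text \<open>
  A series in variables of type \<open>'v\<close> is an arbitrary assignment of coefficients to exponent
  vectors; an exponent vector is a finitely supported function from variables to naturals.
\<close>

typedef ('v, 'a) mfps = "UNIV :: (('v \<Rightarrow>\<^sub>0 nat) \<Rightarrow> 'a) set"
  morphisms mfps_nth Abs_mfps ..

lemma mfps_nth_Abs [simp]: "mfps_nth (Abs_mfps f) m = f m"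
  by (simp add: Abs_mfps_inverse)

lemma mfps_eqI: "(\<And>m. mfps_nth f m = mfps_nth g m) \<Longrightarrow> f = g"
  by (metis ext mfps_nth_inject)

definition mfps_splits :: "('v \<Rightarrow>\<^sub>0 nat) \<Rightarrow> (('v \<Rightarrow>\<^sub>0 nat) \<times> ('v \<Rightarrow>\<^sub>0 nat)) set" where
  "mfps_splits m = {(a, b). a + b = m}"

lemma finite_mfps_splits [simp]: "finite (mfps_splits m)"
proof -
  let ?A = "{a. \<forall>i. Poly_Mapping.lookup a i \<le> Poly_Mapping.lookup m i}"
  let ?R = "\<lambda>a. restrict (Poly_Mapping.lookup a) (Poly_Mapping.keys m)"
  have "?R ` ?A \<subseteq> Pi\<^sub>E (Poly_Mapping.keys m) (\<lambda>i. {..Poly_Mapping.lookup m i})"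
    by auto
  moreover have "finite (Pi\<^sub>E (Poly_Mapping.keys m) (\<lambda>i. {..Poly_Mapping.lookup m i}))"
    by (intro finite_PiE) auto
  ultimately have "finite (?R ` ?A)"
    by (rule finite_subset)
  moreover have "inj_on ?R ?A"
  proof (rule inj_onI)
    fix a b assume a: "a \<in> ?A" and b: "b \<in> ?A" and eq: "?R a = ?R b"
    have "Poly_Mapping.lookup a i = Poly_Mapping.lookup b i" for i
    proof (cases "i \<in> Poly_Mapping.keys m")
      case True
      then show ?thesis using fun_cong [OF eq, of i] by simp
    next
      case False
      then have "Poly_Mapping.lookup m i = 0" by (simp add: in_keys_iff)
      then show ?thesis using a b by (metis le_zero_eq mem_Collect_eq)
    qed
    then show "a = b" by (intro poly_mapping_eqI)
  qed
  ultimately have "finite ?A"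
    by (rule finite_imageD)
  then have "finite (?A \<times> ?A)" by simp
  moreover have "mfps_splits m \<subseteq> ?A \<times> ?A"
    by (auto simp: mfps_splits_def lookup_add)
  ultimately show ?thesis
    by (rule rev_finite_subset)
qed

instantiation mfps :: (type, zero) zero
begin
definition "0 = Abs_mfps (\<lambda>_. 0)"
instance ..
end

instantiation mfps :: (type, zero_neq_one) one
begin
definition "1 = Abs_mfps (\<lambda>m. if m = 0 then 1 else 0)"
instance ..
end

instantiation mfps :: (type, plus) plus
begin
definition "f + g = Abs_mfps (\<lambda>m. mfps_nth f m + mfps_nth g m)"
instance ..
end

instantiation mfps :: (type, minus) minus
begin
definition "f - g = Abs_mfps (\<lambda>m. mfps_nth f m - mfps_nth g m)"
instance ..
end

instantiation mfps :: (type, uminus) uminus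
begin
definition "- f = Abs_mfps (\<lambda>m. - mfps_nth f m)"
instance ..
end

instantiation mfps :: (type, "{comm_monoid_add, times}") times
begin
definition "f * g = Abs_mfps (\<lambda>m. \<Sum>(a, b)\<in>mfps_splits m. mfps_nth f a * mfps_nth g b)"
instance ..
end

lemma mfps_nth_zero [simp]: "mfps_nth 0 m = 0"
  and mfps_nth_one: "mfps_nth 1 m = (if m = 0 then 1 else 0)"
  and mfps_nth_add [simp]: "mfps_nth (f + g) m = mfps_nth f m + mfps_nth g m"
  and mfps_nth_diff [simp]: "mfps_nth (f' - g') m = mfps_nth f' m - mfps_nth g' m"
  and mfps_nth_uminus [simp]: "mfps_nth (- h) m = - mfps_nth h m"
  and mfps_nth_mult:
    "mfps_nth (p * q) m = (\<Sum>(a, b)\<in>mfps_splits m. mfps_nth p a * mfps_nth q b)"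
  by (simp_all add: zero_mfps_def one_mfps_def plus_mfps_def minus_mfps_def uminus_mfps_def
      times_mfps_def)

instance mfps :: (type, comm_ring_1) comm_ring_1
proof
  fix f g h :: "('a, 'b) mfps"
  show "f + g + h = f + (g + h)" "f + g = g + f" "0 + f = f" "- f + f = 0" "f - g = f + - g"
    by (auto intro!: mfps_eqI simp: algebra_simps)
  show "(f + g) * h = f * h + g * h"
    by (rule mfps_eqI)
      (simp add: mfps_nth_mult algebra_simps sum.distrib split_def)
  show "f * g = g * f"
    by (rule mfps_eqI, unfold mfps_nth_mult,
        rule sum.reindex_bij_witness [of _ prod.swap prod.swap])
      (auto simp: mfps_splits_def algebra_simps)
  show "1 * f = f"
  proof (rule mfps_eqI)
    fix m
    have "mfps_nth (1 * f) m = (\<Sum>(a, b)\<in>{(0, m)}. mfps_nth (1 :: ('a, 'b) mfps) a * mfps_nth f b)"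
      unfolding mfps_nth_mult
      by (rule sum.mono_neutral_right [OF finite_mfps_splits])
        (auto simp: mfps_splits_def mfps_nth_one split: if_splits)
    then show "mfps_nth (1 * f) m = mfps_nth f m"
      by (simp add: mfps_nth_one)
  qed
  show "f * g * h = f * (g * h)"
  proof (rule mfps_eqI)
    fix m
    have "mfps_nth (f * g * h) m =
        (\<Sum>(p, c)\<in>mfps_splits m. \<Sum>(a, b)\<in>mfps_splits p.
          mfps_nth f a * mfps_nth g b * mfps_nth h c)"
      by (simp add: mfps_nth_mult sum_distrib_right split_def)
    also have "\<dots> = (\<Sum>((p, c), (a, b))\<in>(SIGMA z:mfps_splits m. mfps_splits (fst z)).
          mfps_nth f a * mfps_nth g b * mfps_nth h c)"
      by (simp add: sum.Sigma split_def)
    also have "\<dots> = (\<Sum>((a, p), (b, c))\<in>(SIGMA z:mfps_splits m. mfps_splits (snd z)).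
          mfps_nth f a * (mfps_nth g b * mfps_nth h c))"
      by (rule sum.reindex_bij_witness
          [of _ "\<lambda>((a, p), (b, c)). ((a + b, c), (a, b))" "\<lambda>((p, c), (a, b)). ((a, b + c), (b, c))"])
        (auto simp: mfps_splits_def algebra_simps)
    also have "\<dots> = mfps_nth (f * (g * h)) m"
      by (simp add: mfps_nth_mult sum_distrib_left sum.Sigma split_def)
    finally show "mfps_nth (f * g * h) m = mfps_nth (f * (g * h)) m" .
  qed
  show "(0 :: ('a, 'b) mfps) \<noteq> 1"
    by (metis mfps_nth_one mfps_nth_zero zero_neq_one)
qed

definition mfps_const :: "'a::zero \<Rightarrow> ('v, 'a) mfps" where
  "mfps_const c = Abs_mfps (\<lambda>m. if m = 0 then c else 0)"

definition mfps_var :: "'v \<Rightarrow> ('v, 'a::zero_neq_one) mfps" where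
  "mfps_var v = Abs_mfps (\<lambda>m. if m = Poly_Mapping.single v 1 then 1 else 0)"

text \<open>The polynomial below is \<open>(1 + x\<^sub>1 z) \<cdots> (1 + x\<^sub>n z)\<close>, in the indeterminate \<open>z\<close>.\<close>

definition elem_sym :: "nat \<Rightarrow> nat \<Rightarrow> (nat, 'a::comm_ring_1) mfps" where
  "elem_sym n k = coeff (\<Prod>i\<in>{1..n}. [:1, mfps_var i:]) k"


section \<open>Consecutive occurrences of increasing patterns in words\<close>

definition words :: "nat \<Rightarrow> (nat \<Rightarrow>\<^sub>0 nat) \<Rightarrow> nat list set" where
  "words n m = {w. set w \<subseteq> {1..n} \<and> (\<forall>i\<in>{1..n}. count_list w i = Poly_Mapping.lookup m i)}"

definition incr_occs :: "nat \<Rightarrow> nat list \<Rightarrow> nat" where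
  "incr_occs r w =
    card {i. i + r \<le> length w \<and> (\<forall>j. j + 1 < r \<longrightarrow> w ! (i + j) < w ! (i + j + 1))}"

text \<open>Polynomials in \<open>t\<close> are of type \<^typ>\<open>int poly\<close>; \<open>monom 1 a\<close> is \<open>t ^ a\<close>.\<close>

definition word_poly :: "nat \<Rightarrow> nat \<Rightarrow> (nat \<Rightarrow>\<^sub>0 nat) \<Rightarrow> int poly" where
  "word_poly n r m = (\<Sum>w\<in>words n m. monom 1 (incr_occs r w))"

lemma finite_words: "finite (words n m)"
proof -
  have "length w = (\<Sum>i\<in>{1..n}. Poly_Mapping.lookup m i)" if "w \<in> words n m" for w
  proof -
    have "(\<Sum>i\<in>{1..n}. count_list w i) = length w"
      using that by (intro sum_count_set) (auto simp: words_def)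
    then show ?thesis using that by (simp add: words_def)
  qed
  then have "words n m \<subseteq> {w. set w \<subseteq> {1..n} \<and> length w = (\<Sum>i\<in>{1..n}. Poly_Mapping.lookup m i)}"
    by (auto simp: words_def)
  then show ?thesis
    by (rule finite_subset) (simp add: finite_lists_length_eq)
qed

text \<open>
  The variables are indexed by all naturals, but only \<open>x\<^sub>1, \<dots>, x\<^sub>n\<close> occur:
  exponent vectors in \<open>\<nat>\<^sup>n\<close> are those supported in \<open>{1..n}\<close>.
\<close>

definition word_gf :: "nat \<Rightarrow> nat \<Rightarrow> (nat, int poly) mfps" where
  "word_gf n r = Abs_mfps (\<lambda>m. if Poly_Mapping.keys m \<subseteq> {1..n} then word_poly n r m else 0)"

fun incr_poly :: "nat \<Rightarrow> nat \<Rightarrow> int poly" where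
  "incr_poly r k =
    (if k < r then 0
     else if k = r then [:-1, 1:]
     else [:-1, 1:] * (\<Sum>i\<in>{1..r - 1}. incr_poly r (k - i)))"

declare incr_poly.simps [simp del]

end

theory Submission
  imports Defs "HOL-Computational_Algebra.Formal_Power_Series"
begin

text \<open>
  A nonempty word \<open>w\<close> whose initial maximal increasing run has length \<open>l\<close> satisfies
  \<open>\<alpha>(w) = max 0 (l - r + 1) + \<alpha>(v)\<close>, where \<open>v\<close> is the word left after this run. Put
  \<open>Q\<^sub>1 = 1\<close> and \<open>Q\<^sub>k = P\<^sub>k\<close> for \<open>k > 1\<close>. The recurrence of the \<open>P\<^sub>k\<close> says precisely that
  \<open>1 - \<Sum> Q\<^sub>k z\<^sup>k\<close> is inverse to \<open>\<Sum> t\<^bsup>max 0 (l - r + 1)\<^esup> z\<^sup>l\<close>. Hence, word by word, \<open>t\<^bsup>\<alpha>(w)\<^esup>\<close> is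
  the sum of \<open>Q\<^sub>k t\<^bsup>\<alpha>(drop k w)\<^esup>\<close> over all \<open>k \<ge> 1\<close> for which the first \<open>k\<close> letters increase.
  As \<open>e\<^sub>k\<close> enumerates the increasing words of length \<open>k\<close>, summing over \<open>w\<close> gives
  \<open>G - 1 = G \<cdot> \<Sum> Q\<^sub>k e\<^sub>k\<close>.
\<close>

section \<open>Power series of the coefficients and of the run weights\<close>

unbundle fps_syntax

definition incr_coeff :: "nat \<Rightarrow> nat \<Rightarrow> int poly" where
  "incr_coeff r k = incr_poly r k + (if k = 1 then 1 else 0)"

lemma incr_poly_less [simp]: "k < r \<Longrightarrow> incr_poly r k = 0"
  by (simp add: incr_poly.simps)

lemma incr_poly_self [simp]: "incr_poly r r = [:-1, 1:]"
  by (simp add: incr_poly.simps)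

lemma incr_coeff_0 [simp]: "r \<ge> 2 \<Longrightarrow> incr_coeff r 0 = 0"
  by (simp add: incr_coeff_def)

lemma sum_fps_X_power_mult_nth:
  fixes F :: "'a::comm_ring_1 fps"
  assumes "finite I"
  shows "((\<Sum>i\<in>I. fps_X ^ i) * F) $ k = (\<Sum>i\<in>I. if k < i then 0 else F $ (k - i))"
  by (simp add: sum_distrib_right fps_sum_nth fps_X_power_mult_nth)

text \<open>The recurrence in series form: multiplication by \<open>S\<close> sums the shifts by
  \<open>1..r - 1\<close>, and the starting value at index \<open>r\<close> gives the right-hand
  side.\<close>

lemma incr_poly_fps:
  fixes r :: nat
  assumes "r \<ge> 1"
  defines "S \<equiv> \<Sum>i\<in>{1..r - 1}. fps_X ^ i"
  shows "(1 - fps_const [:-1, 1:] * S) * Abs_fps (incr_poly r) = fps_const [:-1, 1:] * fps_X ^ r"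
proof -
  let ?c = "fps_const [:-1, 1:] :: int poly fps"
  have "Abs_fps (incr_poly r) = ?c * (S * Abs_fps (incr_poly r)) + ?c * fps_X ^ r"
  proof (rule fps_ext)
    fix k
    have S: "(S * Abs_fps (incr_poly r)) $ k =
        (\<Sum>i\<in>{1..r - 1}. if k < i then 0 else incr_poly r (k - i))"
      unfolding S_def by (subst sum_fps_X_power_mult_nth) (simp_all cong: if_cong)
    \<comment> \<open>Since \<open>i \<ge> 1\<close>, every index \<open>k - i\<close> is below
      \<open>r\<close>, where \<open>incr_poly\<close> vanishes.\<close>
    have *: "(S * Abs_fps (incr_poly r)) $ k = 0" if "k \<le> r"
      unfolding S by (rule sum.neutral) (use that assms in auto)
    have **: "(S * Abs_fps (incr_poly r)) $ k = (\<Sum>i\<in>{1..r - 1}. incr_poly r (k - i))" if "k > r"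
      unfolding S by (rule sum.cong) (use that in auto)
    consider "k < r" | "k = r" | "k > r" by linarith
    then show "Abs_fps (incr_poly r) $ k =
        (?c * (S * Abs_fps (incr_poly r)) + ?c * fps_X ^ r) $ k"
    proof cases
      case 3
      then have "Abs_fps (incr_poly r) $ k = [:-1, 1:] * (\<Sum>i\<in>{1..r - 1}. incr_poly r (k - i))"
        by (simp add: incr_poly.simps [of r k])
      with 3 show ?thesis by (simp add: **)
    next
      case 2
      then show ?thesis using * by simp
    qed (simp add: *)
  qed
  then show ?thesis
    by (simp add: algebra_simps)
qed

text \<open>The subtraction is truncated, so the series has coefficients 1 up to index
  \<open>r - 1\<close> and is geometric with ratio \<open>t\<close> from there on. Multiplying by
  \<open>1 - t X\<close> kills everything from index \<open>r\<close> on and leaves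
  \<open>1 - t\<close> at the indices \<open>1..r - 1\<close>.\<close>

lemma run_fps:
  fixes r :: nat
  assumes "r \<ge> 2"
  defines "S \<equiv> \<Sum>i\<in>{1..r - 1}. fps_X ^ i"
  shows "(1 - fps_const [:0, 1:] * fps_X) * Abs_fps (\<lambda>l. monom 1 (l + 1 - r)) =
    (1 - fps_const [:-1, 1:] * S :: int poly fps)"
proof (rule fps_ext)
  fix l
  let ?A = "Abs_fps (\<lambda>l. monom 1 (l + 1 - r)) :: int poly fps"
  have S: "S $ l = (if 1 \<le> l \<and> l < r then 1 else (0 :: int poly))"
  proof -
    have "S $ l = (\<Sum>i\<in>{1..r - 1}. if l = i then 1 else (0 :: int poly))"
      by (simp add: S_def fps_sum_nth)
    then show ?thesis using assms by (auto simp: sum.delta)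
  qed
  have T: "[:0, 1:] * monom 1 j = (monom 1 (Suc j) :: int poly)" for j
    by (simp add: monom_Suc)
  have "((1 - fps_const [:0, 1:] * fps_X) * ?A) $ l
      = ?A $ l - [:0, 1:] * (if l = 0 then 0 else ?A $ (l - 1))"
    by (simp add: left_diff_distrib mult.assoc)
  also have "\<dots> = (1 - fps_const [:-1, 1:] * S) $ l"
  proof (cases "1 \<le> l \<and> l < r")
    case True
    then have "l + 1 - r = 0" "l - 1 + 1 - r = 0" "l \<noteq> 0" by auto
    then show ?thesis using True by (simp add: S one_pCons)
  next
    case False
    then consider "l = 0" | "l \<ge> r" by linarith
    then show ?thesis
    proof cases
      case 2
      then have "Suc (l - r) = l + 1 - r" "l - 1 + 1 - r = l - r" "l \<noteq> 0" using assms by auto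
      then show ?thesis using 2 by (simp add: S T del: mult_pCons_left)
    next
      case 1
      then show ?thesis using assms(1) S by (simp del: One_nat_def)
    qed
  qed
  finally show "((1 - fps_const [:0, 1:] * fps_X) * ?A) $ l = (1 - fps_const [:-1, 1:] * S) $ l" .
qed

text \<open>Both series are known up to the factor \<open>1 - ?c * S\<close>. Hence the identity is
  proved after multiplication by \<open>1 - ?T * fps_X\<close>, which is nonzero and cancels in an
  integral domain.\<close>

lemma run_fps_inverse:
  assumes "r \<ge> 2"
  shows "Abs_fps (\<lambda>l. monom 1 (l + 1 - r)) * (1 - Abs_fps (incr_coeff r)) = 1"
proof -
  let ?A = "Abs_fps (\<lambda>l. monom 1 (l + 1 - r)) :: int poly fps"
  let ?P = "Abs_fps (incr_poly r)"
  let ?c = "fps_const [:-1, 1:] :: int poly fps"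
  let ?T = "fps_const [:0, 1:] :: int poly fps"
  define S :: "int poly fps" where "S = (\<Sum>i\<in>{1..r - 1}. fps_X ^ i)"
  have T: "?T = 1 + ?c"
    by (rule fps_ext) (simp add: one_pCons)
  have Q: "Abs_fps (incr_coeff r) = fps_X + ?P"
    by (rule fps_ext) (simp add: incr_coeff_def fps_X_def)
  have S: "(1 - fps_X) * S = fps_X - fps_X ^ r"
    using assms sum_gp_multiplied [of 1 "r - 1" "fps_X :: int poly fps"] by (simp add: S_def)
  have A: "(1 - ?T * fps_X) * ?A = 1 - ?c * S"
    using run_fps [OF assms] by (simp add: S_def)
  have P: "(1 - ?c * S) * ?P = ?c * fps_X ^ r"
    using incr_poly_fps [of r] assms by (simp add: S_def)
  have "(1 - ?T * fps_X) * (?A * (1 - Abs_fps (incr_coeff r)))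
      = (1 - ?c * S) * (1 - fps_X - ?P)"
    by (simp only: A [symmetric] Q mult.assoc diff_diff_eq)
  also have "\<dots> = (1 - fps_X) - ?c * ((1 - fps_X) * S) - (1 - ?c * S) * ?P"
    by (simp add: algebra_simps)
  \<comment> \<open>After substituting \<open>S\<close> and \<open>P\<close>, the two terms
    \<open>?c * fps_X ^ r\<close> cancel.\<close>
  also have "\<dots> = (1 - ?T * fps_X) * 1"
    unfolding S P T by (simp add: algebra_simps)
  finally have "(1 - ?T * fps_X) * (?A * (1 - Abs_fps (incr_coeff r))) = (1 - ?T * fps_X) * 1" .
  moreover have "1 - ?T * fps_X \<noteq> 0"
  proof
    assume "1 - ?T * fps_X = 0"
    then have "(1 - ?T * fps_X) $ 0 = 0" by (simp only: fps_zero_nth)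
    then show False by simp
  qed
  ultimately show ?thesis
    by (simp only: mult_cancel_left) simp
qed

text \<open>The case of a single increasing run: compare coefficients at \<open>l\<close> in the
  inverse relation, whose constant 1 is invisible for \<open>l \<ge> 1\<close>.\<close>

lemma monom_run_eq_sum:
  assumes "r \<ge> 2" and "l \<ge> 1"
  shows "(\<Sum>k\<in>{0..l}. incr_coeff r k * monom 1 (l - k + 1 - r)) = monom 1 (l + 1 - r)"
proof -
  let ?A = "Abs_fps (\<lambda>l. monom 1 (l + 1 - r)) :: int poly fps"
  have "?A = 1 + Abs_fps (incr_coeff r) * ?A"
    using run_fps_inverse [OF assms(1)] by (simp add: algebra_simps)
  then have "?A $ l = (1 + Abs_fps (incr_coeff r) * ?A) $ l"
    by simp
  then show ?thesis using assms(2) by (simp add: fps_mult_nth)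
qed

section \<open>Pattern occurrences and increasing runs\<close>

lemma incr_occs_altdef:
  "incr_occs r w = card {i. i + r \<le> length w \<and> sorted_wrt (<) (take r (drop i w))}"
proof -
  have "(\<forall>j. j + 1 < r \<longrightarrow> w ! (i + j) < w ! (i + j + 1)) \<longleftrightarrow> sorted_wrt (<) (take r (drop i w))"
    if "i + r \<le> length w" for i
    using that by (subst sorted_wrt_iff_nth_Suc_transp) (auto simp: min_def)
  then show ?thesis
    unfolding incr_occs_def by (metis (lifting))
qed

lemma incr_occs_Nil: "r \<ge> 1 \<Longrightarrow> incr_occs r [] = 0"
  by (simp add: incr_occs_altdef)

text \<open>Only an occurrence at position 0 involves \<open>x\<close>; the others are shifts of
  those in \<open>w\<close>.\<close>

lemma incr_occs_Cons:
  "incr_occs r (x # w) =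
    (if r \<le> length (x # w) \<and> sorted_wrt (<) (take r (x # w)) then 1 else 0) + incr_occs r w"
proof -
  let ?O = "\<lambda>w. {i. i + r \<le> length w \<and> sorted_wrt (<) (take r (drop i w))}"
  have fin: "finite (?O w)"
    by (rule finite_subset [of _ "{..length w}"]) auto
  let ?Z = "if r \<le> length (x # w) \<and> sorted_wrt (<) (take r (x # w)) then {0} else {} :: nat set"
  have "?O (x # w) = ?Z \<union> Suc ` ?O w"
  proof (rule set_eqI)
    fix i show "i \<in> ?O (x # w) \<longleftrightarrow> i \<in> ?Z \<union> Suc ` ?O w"
      by (cases i) (auto simp: image_iff)
  qed
  then have "card (?O (x # w)) = card (?Z \<union> Suc ` ?O w)"
    by (rule arg_cong)
  then have "card (?O (x # w)) = card ?Z + card (Suc ` ?O w)"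
    using fin by (subst (asm) card_Un_disjoint) auto
  then have "incr_occs r (x # w) = card ?Z + incr_occs r w"
    by (simp only: incr_occs_altdef card_image inj_Suc)
  then show ?thesis
    by (simp only: if_distrib [of card] card.empty) simp
qed

text \<open>No occurrence straddles the non-ascent between \<open>u\<close> and \<open>v\<close>, so
  those starting in \<open>u\<close> are the windows of length \<open>r\<close> that fit inside
  \<open>u\<close>.\<close>

lemma incr_occs_run_append:
  assumes "r \<ge> 2" and "sorted_wrt (<) u" and "u = [] \<or> v = [] \<or> \<not> last u < hd v"
  shows "incr_occs r (u @ v) = (length u + 1 - r) + incr_occs r v"
  using assms(2,3)
proof (induction u)
  case Nil
  then show ?case using assms(1) by simp
next
  case (Cons x u)
  have IH: "incr_occs r (u @ v) = (length u + 1 - r) + incr_occs r v"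
    using Cons by (auto split: if_splits)
  \<comment> \<open>A window starting at \<open>x\<close> and leaving \<open>x # u\<close> would
    force an ascent from \<open>last (x # u)\<close> to the head of \<open>v\<close>.\<close>
  have "r \<le> length (x # u @ v) \<and> sorted_wrt (<) (take r (x # u @ v)) \<longleftrightarrow> r \<le> length (x # u)"
    (is "?L \<longleftrightarrow> ?R")
  proof
    assume L: ?L
    show ?R
    proof (rule ccontr)
      assume "\<not> ?R"
      then have r: "r > length (x # u)" by simp
      with L have "v \<noteq> []" by auto
      then obtain y v' where v: "v = y # v'" by (cases v) auto
      obtain j where "r = length (x # u) + Suc j"
        using r less_iff_Suc_add by auto
      then have "take r (x # u @ v) = (x # u) @ y # take j v'"
        by (simp add: v)
      with L have "sorted_wrt (<) ((x # u) @ y # take j v')"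
        by metis
      then have "last (x # u) < y"
        unfolding sorted_wrt_append by (metis last_in_set list.distinct(1) list.set_intros(1))
      with Cons.prems v show False by simp
    qed
  next
    assume R: ?R
    then have "take r (x # u @ v) = take r (x # u)" by (cases r) auto
    then show ?L using R Cons.prems(1) sorted_wrt_take [of "(<)" "x # u" r] by auto
  qed
  then have "incr_occs r (x # u @ v) = (if r \<le> length (x # u) then 1 else 0) + incr_occs r (u @ v)"
    by (simp only: incr_occs_Cons)
  \<comment> \<open>The truncated difference grows by one exactly when
    \<open>r \<le> length (x # u)\<close>.\<close>
  then show ?case
    by (simp add: IH split: if_splits)
qed

lemma ex_maximal_run:
  fixes w :: "'a::linorder list"
  assumes "w \<noteq> []"
  shows "\<exists>u v. w = u @ v \<and> u \<noteq> [] \<and> sorted_wrt (<) u \<and> (v = [] \<or> \<not> last u < hd v)"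
  using assms
proof (induction w)
  case (Cons x w)
  show ?case
  proof (cases "w = [] \<or> \<not> x < hd w")
    case True
    then show ?thesis by (intro exI [of _ "[x]"] exI [of _ w]) auto
  next
    case False
    then obtain u v where uv: "w = u @ v" "u \<noteq> []" "sorted_wrt (<) u" "v = [] \<or> \<not> last u < hd v"
      using Cons.IH by auto
    then obtain y u' where u: "u = y # u'" by (cases u) auto
    have "x < y" using False uv(1) u by simp
    then have "sorted_wrt (<) (x # u)"
      using uv(3) unfolding u by auto
    then show ?thesis using uv by (intro exI [of _ "x # u"] exI [of _ v]) auto
  qed
qed simp

text \<open>The identity for one word. Only prefixes of the maximal run \<open>u\<close> increase,
  and removing \<open>k\<close> letters leaves a run of length \<open>length u - k\<close> before
  \<open>v\<close>. The weight of \<open>v\<close> factors out, and the identity for a single run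
  remains.\<close>

lemma sum_incr_prefixes:
  assumes r: "r \<ge> 2" and "w \<noteq> []"
  shows "(\<Sum>k | k \<le> length w \<and> sorted_wrt (<) (take k w).
      incr_coeff r k * monom 1 (incr_occs r (drop k w))) = monom 1 (incr_occs r w)"
proof -
  obtain u v where w: "w = u @ v" and u: "u \<noteq> []" "sorted_wrt (<) u"
    and v: "v = [] \<or> \<not> last u < hd v"
    using ex_maximal_run [OF assms(2)] by blast
  have "k \<le> length w \<and> sorted_wrt (<) (take k w) \<longleftrightarrow> k \<le> length u" for k
  proof
    assume k: "k \<le> length w \<and> sorted_wrt (<) (take k w)"
    show "k \<le> length u"
    proof (rule ccontr)
      assume *: "\<not> k \<le> length u"
      with k w obtain y v' where v': "v = y # v'" by (cases v) auto
      obtain j where "k = length u + Suc j"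
        using * less_iff_Suc_add by (auto simp: not_le)
      then have "take k w = u @ y # take j v'"
        by (simp add: w v')
      with k have "last u < y"
        using u(1) by (auto simp: sorted_wrt_append)
      with v v' show False by simp
    qed
  next
    assume "k \<le> length u"
    then show "k \<le> length w \<and> sorted_wrt (<) (take k w)"
      using u(2) by (simp add: w sorted_wrt_take)
  qed
  then have prefixes: "{k. k \<le> length w \<and> sorted_wrt (<) (take k w)} = {0..length u}"
    by (simp only: atLeast0AtMost atMost_def)
  have drop: "incr_occs r (drop k w) = (length u - k + 1 - r) + incr_occs r v"
    if "k \<le> length u" for k
  proof -
    \<comment> \<open>For \<open>k < length u\<close> the shortened run keeps its last letter; for
      \<open>k = length u\<close> it is empty.\<close>
    have "drop k u = [] \<or> v = [] \<or> \<not> last (drop k u) < hd v"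
      using v by (cases "k < length u") (simp_all add: last_drop)
    with sorted_wrt_drop [OF u(2)] show ?thesis
      using incr_occs_run_append [OF r, of "drop k u" v] that by (simp add: w)
  qed
  have "(\<Sum>k | k \<le> length w \<and> sorted_wrt (<) (take k w).
      incr_coeff r k * monom 1 (incr_occs r (drop k w)))
    = (\<Sum>k\<in>{0..length u}. incr_coeff r k * monom 1 (length u - k + 1 - r) * monom 1 (incr_occs r v))"
    unfolding prefixes
  proof (rule sum.cong [OF refl])
    fix k assume "k \<in> {0..length u}"
    then have "k \<le> length u" by simp
    show "incr_coeff r k * monom 1 (incr_occs r (drop k w)) =
        incr_coeff r k * monom 1 (length u - k + 1 - r) * monom 1 (incr_occs r v)"
      unfolding drop [OF \<open>k \<le> length u\<close>] mult.assoc mult_monom by simp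
  qed
  also have "\<dots> = monom 1 ((length u + 1 - r) + incr_occs r v)"
    unfolding sum_distrib_right [symmetric]
    using u(1) by (subst monom_run_eq_sum [OF r]) (simp_all add: mult_monom Suc_le_eq)
  also have "(length u + 1 - r) + incr_occs r v = incr_occs r w"
    using incr_occs_run_append [OF r u(2)] v by (simp add: w)
  finally show ?thesis .
qed

section \<open>Words sorted by content\<close>

text \<open>This is the exponent vector of the monomial that \<open>w\<close> becomes when letters
  commute. Additivity under concatenation matches the splittings in
  \<open>mfps_splits\<close>.\<close>

definition word_content :: "'a list \<Rightarrow> 'a \<Rightarrow>\<^sub>0 nat" where
  "word_content w = (\<Sum>x\<leftarrow>w. Poly_Mapping.single x 1)"

lemma word_content_Nil [simp]: "word_content [] = 0"
  and word_content_Cons: "word_content (x # w) = Poly_Mapping.single x 1 + word_content w"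
  and word_content_append [simp]: "word_content (u @ v) = word_content u + word_content v"
  by (simp_all add: word_content_def)

lemma word_content_drop_take: "word_content (drop k w) + word_content (take k w) = word_content w"
  by (metis word_content_append append_take_drop_id add.commute)

lemma lookup_word_content: "Poly_Mapping.lookup (word_content w) x = count_list w x"
  by (induction w) (auto simp: word_content_Cons lookup_add lookup_single when_def)

lemma word_content_eq_0_iff [simp]: "word_content w = 0 \<longleftrightarrow> w = []"
proof
  assume "word_content w = 0"
  then have "count_list w x = 0" for x
    by (metis lookup_word_content lookup_zero)
  then show "w = []"
    by (metis count_list_0_iff list.set_intros(1) neq_Nil_conv)
qed simp

text \<open>Unlike \<open>words\<close>, this constrains the exponents outside \<open>{1..n}\<close>
  as well, so the case distinction in \<open>word_gf\<close> disappears.\<close>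

definition content_words :: "nat \<Rightarrow> (nat \<Rightarrow>\<^sub>0 nat) \<Rightarrow> nat list set" where
  "content_words n m = {w. set w \<subseteq> {1..n} \<and> word_content w = m}"

lemma content_words_eq:
  "content_words n m = (if Poly_Mapping.keys m \<subseteq> {1..n} then words n m else {})"
proof -
  have "word_content w = m \<longleftrightarrow>
      Poly_Mapping.keys m \<subseteq> {1..n} \<and> (\<forall>i\<in>{1..n}. count_list w i = Poly_Mapping.lookup m i)"
    if w: "set w \<subseteq> {1..n}" for w
  proof
    assume *: "word_content w = m"
    have "x \<in> set w" if "x \<in> Poly_Mapping.keys m" for x
      using that unfolding *[symmetric] in_keys_iff lookup_word_content by (metis count_list_0_iff)
    then show "Poly_Mapping.keys m \<subseteq> {1..n} \<and> (\<forall>i\<in>{1..n}. count_list w i = Poly_Mapping.lookup m i)"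
      using w * by (auto simp: lookup_word_content)
  next
    assume *: "Poly_Mapping.keys m \<subseteq> {1..n} \<and> (\<forall>i\<in>{1..n}. count_list w i = Poly_Mapping.lookup m i)"
    show "word_content w = m"
    proof (rule poly_mapping_eqI)
      fix x
      show "Poly_Mapping.lookup (word_content w) x = Poly_Mapping.lookup m x"
      proof (cases "x \<in> {1..n}")
        case False
        then have "x \<notin> set w" "x \<notin> Poly_Mapping.keys m" using w * by blast+
        then show ?thesis by (simp add: lookup_word_content in_keys_iff count_list_0_iff)
      qed (use * in \<open>simp add: lookup_word_content\<close>)
    qed
  qed
  then show ?thesis
    unfolding content_words_def words_def by auto
qed

lemma finite_content_words [simp]: "finite (content_words n m)"
  by (simp add: content_words_eq finite_words)

lemma word_gf_nth: "mfps_nth (word_gf n r) m = (\<Sum>w\<in>content_words n m. monom 1 (incr_occs r w))"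
  by (simp add: word_gf_def word_poly_def content_words_eq)

section \<open>Elementary symmetric polynomials as sums over increasing words\<close>

lemma mfps_nth_sum:
  fixes f :: "'b \<Rightarrow> ('v, 'a::comm_ring_1) mfps"
  shows "mfps_nth (\<Sum>x\<in>A. f x) m = (\<Sum>x\<in>A. mfps_nth (f x) m)"
  by (induction A rule: infinite_finite_induct) auto

lemma mfps_nth_const_mult:
  fixes f :: "('v, 'a::comm_ring_1) mfps"
  shows "mfps_nth (mfps_const c * f) m = c * mfps_nth f m"
proof -
  have "mfps_nth (mfps_const c * f) m = (\<Sum>(a, b)\<in>{(0, m)}.
      mfps_nth (mfps_const c :: ('v, 'a) mfps) a * mfps_nth f b)"
    unfolding mfps_nth_mult
    by (rule sum.mono_neutral_right [OF finite_mfps_splits])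
      (auto simp: mfps_splits_def mfps_const_def split: if_splits)
  then show ?thesis by (simp add: mfps_const_def)
qed

lemma mfps_var_mult_monomial:
  "mfps_var v * Abs_mfps (\<lambda>m. if m = a then 1 else 0) =
    (Abs_mfps (\<lambda>m. if m = Poly_Mapping.single v 1 + a then 1 else 0) :: ('v, 'a::comm_ring_1) mfps)"
proof (rule mfps_eqI)
  fix m
  let ?f = "\<lambda>(b, c). mfps_nth (mfps_var v :: ('v, 'a) mfps) b *
    mfps_nth (Abs_mfps (\<lambda>m. if m = a then 1 else 0) :: ('v, 'a) mfps) c"
  have "sum ?f (mfps_splits m) = sum ?f (mfps_splits m \<inter> {(Poly_Mapping.single v 1, a)})"
    by (rule sum.mono_neutral_right) (auto simp: mfps_var_def split: if_splits)
  also have "\<dots> = (if m = Poly_Mapping.single v 1 + a then 1 else 0)"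
    by (auto simp: mfps_splits_def mfps_var_def)
  finally show "mfps_nth (mfps_var v * Abs_mfps (\<lambda>m. if m = a then 1 else 0)) m =
    mfps_nth (Abs_mfps (\<lambda>m. if m = Poly_Mapping.single v 1 + a then 1 else 0) :: ('v, 'a) mfps) m"
    by (simp add: mfps_nth_mult)
qed

lemma prod_list_mfps_var:
  "(\<Prod>x\<leftarrow>w. mfps_var x) =
    (Abs_mfps (\<lambda>m. if m = word_content w then 1 else 0) :: ('v, 'a::comm_ring_1) mfps)"
  by (induction w) (simp_all add: one_mfps_def mfps_var_mult_monomial word_content_Cons)

text \<open>Expanding the product chooses the set \<open>A\<close> of factors that contribute their
  linear term; the exponent of \<open>z\<close> is then \<open>card A\<close>.\<close>

lemma elem_sym_eq_sum:
  "elem_sym n k = (\<Sum>A | A \<subseteq> {1..n} \<and> card A = k. \<Prod>x\<in>A. mfps_var x :: (nat, 'a::comm_ring_1) mfps)"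
proof -
  let ?x = "mfps_var :: nat \<Rightarrow> (nat, 'a) mfps"
  have p: "(\<Prod>i\<in>A. monom (?x i) 1) = monom (\<Prod>i\<in>A. ?x i) (card A)" if "finite A" for A
    using that by (induction A) (auto simp: mult_monom one_pCons monom_0)
  have "(\<Prod>i\<in>{1..n}. [:1, ?x i:]) = (\<Prod>i\<in>{1..n}. monom (?x i) 1 + 1)"
    by (simp add: monom_altdef one_pCons)
  also have "\<dots> = (\<Sum>A\<in>Pow {1..n}. \<Prod>i\<in>A. monom (?x i) 1)"
    by (subst prod_add) simp_all
  also have "\<dots> = (\<Sum>A\<in>Pow {1..n}. monom (\<Prod>i\<in>A. ?x i) (card A))"
    by (intro sum.cong refl p) (auto intro: finite_subset)
  finally have "elem_sym n k = (\<Sum>A\<in>Pow {1..n}. if card A = k then \<Prod>i\<in>A. ?x i else 0)"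
    by (simp add: elem_sym_def coeff_sum)
  then show ?thesis
    by (simp add: sum.If_cases Collect_conj_eq Pow_def)
qed

text \<open>Sorting identifies the \<open>k\<close>-subsets of \<open>{1..n}\<close> with the
  strictly increasing words of length \<open>k\<close>.\<close>

lemma elem_sym_nth:
  "mfps_nth (elem_sym n k :: (nat, 'a::comm_ring_1) mfps) m =
    (\<Sum>u | u \<in> content_words n m \<and> sorted_wrt (<) u \<and> length u = k. 1)"
proof -
  let ?U = "{u. set u \<subseteq> {1..n} \<and> sorted_wrt (<) u \<and> length u = k}"
  have fin: "finite ?U"
    by (rule finite_subset [OF _ finite_lists_length_eq [of "{1..n}" k]]) auto
  have finA: "finite A" if "A \<subseteq> {1..n}" for A
    using that by (rule finite_subset) simp
  have prod: "(\<Prod>x\<in>set u. mfps_var x :: (nat, 'a) mfps) = (\<Prod>x\<leftarrow>u. mfps_var x)"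
    if "sorted_wrt (<) u" for u :: "nat list"
    using that by (simp add: strict_sorted_iff prod.distinct_set_conv_list)
  have "(elem_sym n k :: (nat, 'a) mfps) = (\<Sum>u\<in>?U. \<Prod>x\<leftarrow>u. mfps_var x)"
    unfolding elem_sym_eq_sum
    by (rule sum.reindex_bij_witness [of _ set sorted_list_of_set])
      (auto simp: prod [symmetric] strict_sorted_iff distinct_card sorted_list_of_set.idem_if_sorted_distinct
          finA simp del: atLeastAtMost_iff)
  then have "mfps_nth (elem_sym n k :: (nat, 'a) mfps) m = (\<Sum>u\<in>?U. if m = word_content u then 1 else 0)"
    by (simp add: mfps_nth_sum prod_list_mfps_var)
  also have "\<dots> = (\<Sum>u\<in>?U \<inter> {u. m = word_content u}. 1)"
    using fin by (subst sum.If_cases) auto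
  also have "?U \<inter> {u. m = word_content u} = {u. u \<in> content_words n m \<and> sorted_wrt (<) u \<and> length u = k}"
    by (auto simp: content_words_def)
  finally show ?thesis .
qed

text \<open>Grouping by length: a strictly increasing word over \<open>{1..n}\<close> has distinct
  letters, so its length lies in \<open>{0..n}\<close>.\<close>

lemma sum_incr_coeff_elem_sym_nth:
  "mfps_nth (\<Sum>k\<in>{0..n}. mfps_const (incr_coeff r k) * elem_sym n k) m =
    (\<Sum>u | u \<in> content_words n m \<and> sorted_wrt (<) u. incr_coeff r (length u))"
proof -
  let ?U = "{u. u \<in> content_words n m \<and> sorted_wrt (<) u}"
  have "length u \<le> n" if "u \<in> ?U" for u
  proof -
    have "length u = card (set u)" using that by (simp add: strict_sorted_iff distinct_card)
    also have "\<dots> \<le> card {1..n}" using that by (intro card_mono) (auto simp: content_words_def)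
    finally show ?thesis by simp
  qed
  then have "(\<Sum>u\<in>?U. incr_coeff r (length u))
      = (\<Sum>k\<in>{0..n}. \<Sum>u | u \<in> ?U \<and> length u = k. incr_coeff r (length u))"
    by (intro sum.group [symmetric]) auto
  also have "\<dots> = (\<Sum>k\<in>{0..n}. incr_coeff r k * mfps_nth (elem_sym n k) m)"
    by (intro sum.cong refl) (simp add: elem_sym_nth sum_distrib_left conj_assoc)
  finally show ?thesis
    by (simp add: mfps_nth_sum mfps_nth_const_mult)
qed

section \<open>The functional equation\<close>

text \<open>The extra 1 in \<open>incr_coeff\<close> at index 1 yields \<open>elem_sym n 1\<close>,
  and \<open>incr_poly r k\<close> vanishes for \<open>k < r\<close>.\<close>

lemma denominator_eq:
  assumes "n \<ge> 1" and "r \<ge> 2"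
  shows "elem_sym n 1 + (\<Sum>k = r..n. mfps_const (incr_poly r k) * elem_sym n k) =
    (\<Sum>k\<in>{0..n}. mfps_const (incr_coeff r k) * elem_sym n k)"
proof (rule mfps_eqI)
  fix m
  let ?e = "\<lambda>k. mfps_nth (elem_sym n k) m :: int poly"
  have "(\<Sum>k\<in>{0..n}. incr_coeff r k * ?e k)
      = (\<Sum>k\<in>{0..n}. if k = 1 then ?e k else 0) + (\<Sum>k\<in>{0..n}. incr_poly r k * ?e k)"
    unfolding sum.distrib [symmetric]
    by (intro sum.cong refl) (simp add: incr_coeff_def algebra_simps)
  also have "(\<Sum>k\<in>{0..n}. incr_poly r k * ?e k) = (\<Sum>k\<in>{r..n}. incr_poly r k * ?e k)"
    by (rule sum.mono_neutral_right) auto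
  finally show "mfps_nth (elem_sym n 1 + (\<Sum>k = r..n. mfps_const (incr_poly r k) * elem_sym n k)) m =
      mfps_nth (\<Sum>k\<in>{0..n}. mfps_const (incr_coeff r k) * elem_sym n k) m"
    using assms by (simp add: mfps_nth_sum mfps_nth_const_mult)
qed

text \<open>The product counts pairs of a word \<open>v\<close> and an increasing word
  \<open>u\<close>, that is, words \<open>u @ v\<close> with a marked increasing prefix. Summing
  over the marks gives back the weight of each nonempty word.\<close>

lemma word_gf_recurrence:
  assumes r: "r \<ge> 2"
  shows "word_gf n r * (\<Sum>k\<in>{0..n}. mfps_const (incr_coeff r k) * elem_sym n k) = word_gf n r - 1"
    (is "_ * ?E = _")
proof (rule mfps_eqI)
  fix m
  let ?I = "\<lambda>w. {k. k \<le> length w \<and> sorted_wrt (<) (take k w)}"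
  let ?U = "\<lambda>m. {u. u \<in> content_words n m \<and> sorted_wrt (<) u}"
  have fin: "finite (?U m)" for m
    by (rule finite_subset [OF _ finite_content_words [of n m]]) auto
  have finI: "finite (?I w)" for w :: "nat list"
    by (rule finite_subset [of _ "{..length w}"]) auto
  have "mfps_nth (word_gf n r * ?E) m =
      (\<Sum>z\<in>mfps_splits m. \<Sum>(v, u)\<in>content_words n (fst z) \<times> ?U (snd z).
        monom 1 (incr_occs r v) * incr_coeff r (length u))"
    by (simp add: mfps_nth_mult word_gf_nth sum_incr_coeff_elem_sym_nth sum_product
        sum.cartesian_product split_def)
  also have "\<dots> = (\<Sum>(z, v, u)\<in>(SIGMA z:mfps_splits m. content_words n (fst z) \<times> ?U (snd z)).
        monom 1 (incr_occs r v) * incr_coeff r (length u))"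
    by (subst sum.Sigma) (auto simp: fin split_def)
  also have "\<dots> = (\<Sum>(w, k)\<in>(SIGMA w:content_words n m. ?I w).
        incr_coeff r k * monom 1 (incr_occs r (drop k w)))"
    \<comment> \<open>Cutting \<open>w\<close> after \<open>k\<close> letters is inverse to gluing;
      the contents of the two pieces recover the splitting \<open>z\<close>.\<close>
    by (rule sum.reindex_bij_witness
        [of _ "\<lambda>(w, k). ((word_content (drop k w), word_content (take k w)), drop k w, take k w)"
          "\<lambda>(z, v, u). (u @ v, length u)"])
      (auto simp: mfps_splits_def content_words_def add.commute word_content_drop_take
        simp del: atLeastAtMost_iff dest: in_set_takeD in_set_dropD)
  also have "\<dots> = (\<Sum>w\<in>content_words n m. \<Sum>k\<in>?I w. incr_coeff r k * monom 1 (incr_occs r (drop k w)))"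
    by (subst sum.Sigma) (auto simp: finI)
  also have "\<dots> = mfps_nth (word_gf n r - 1) m"
  proof (cases "m = 0")
    case True
    \<comment> \<open>The empty word has the single prefix length 0, whose coefficient is 0; this
      accounts for the subtracted 1.\<close>
    have "content_words n 0 = {[]}" by (auto simp: content_words_def)
    moreover have "?I ([] :: nat list) = {0}" by auto
    ultimately show ?thesis
      using r True by (simp add: word_gf_nth mfps_nth_one incr_occs_Nil)
  next
    case False
    then have "w \<noteq> []" if "w \<in> content_words n m" for w
      using that by (auto simp: content_words_def)
    then show ?thesis
      using False by (simp add: sum_incr_prefixes [OF r] word_gf_nth mfps_nth_one)
  qed
  finally show "mfps_nth (word_gf n r * ?E) m = mfps_nth (word_gf n r - 1) m" .
qed

theorem theorem2:
  fixes n r :: nat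
  assumes "n \<ge> 1" and "r \<ge> 2"
  shows "word_gf n r *
    (1 - elem_sym n 1 - (\<Sum>k = r..n. mfps_const (incr_poly r k) * elem_sym n k)) = 1"
proof -
  have "word_gf n r * (1 - (\<Sum>k\<in>{0..n}. mfps_const (incr_coeff r k) * elem_sym n k)) = 1"
    by (simp add: right_diff_distrib word_gf_recurrence [OF assms(2)])
  then show ?thesis
    by (simp only: diff_diff_eq denominator_eq [OF assms])
qed

end
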